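(* Let $p\in(0,1)$. Suppose that $F\in \mathcal{F}^{-}_{1}$, and let $F_1,F_2,\ldots \in \mathcal{F}^{-}_{1}$ be any sequence of (possibly random) cdf's such that $\sup_{x\in \mathbb{R}} | F_n(x) - F(x)| \stackrel{\mathbb{P}}{\to} 0$ when $n\to \infty$. Then $$\int_0^p F_n^{-1}(u)\, du - \int_0^p F^{-1}(u)\, du =\int_{-\infty }^{F^{-1}(p)} \big( F(x)- F_n(x)\big)\, dx +o_{\mathbb{P}}(1)$$ and, therefore, the consistency statement $$\int_0^p F_n^{-1}(u)\, du \stackrel{\mathbb{P}}{\to} \int_0^p F^{-1}(u)\, du$$ holds if and only if $$\int_{-\infty }^{F^{-1}(p)} F_n(x)\, dx \stackrel{\mathbb{P}}{\to} \int_{-\infty }^{F^{-1}(p)}F(x)\, dx .$$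
   Context: The quantile function of a cdf $F$ is $F^{-1}(u)=\inf\{x\in\mathbb{R}: F(x)\ge u\}$ for $u\in(0,1]$ and $F^{-1}(0)=\lim_{u\downarrow 0}F^{-1}(u)$. The class $\mathcal{F}^{-}_{1}$ consists of all (deterministic) cdf's $F$ for which $\int_0^p F^{-1}(u)\,du$ is finite (for $p\in(0,1)$); equivalently, $\mathbb{E}(X^{-})<\infty$ for $X\sim F$, where $X^{-}=(-X)\vee 0$. The cdf $F$ is deterministic. The $F_n$ may be random: on an underlying probability space $(\Omega,\mathcal{A},\mathbb{P})$, $F_n:\Omega\times\mathbb{R}\to[0,1]$ is jointly measurable and $F_n(\omega,\cdot)$ is a cdf for almost all $\omega$; $F_n\in\mathcal{F}^{-}_{1}$ means that $F_n(\omega,\cdot)\in\mathcal{F}^{-}_{1}$ for almost all $\omega$. No particular sampling design or dependence structure is assumed. $\stackrel{\mathbb{P}}{\to}$ denotes convergence in probability, and $o_{\mathbb{P}}(1)$ denotes a term converging to $0$ in probability as $n\to\infty$. *)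

theory Defs
  imports "HOL-Probability.Probability"
begin

definition is_cdf :: "(real \<Rightarrow> real) \<Rightarrow> bool" where
  "is_cdf F \<longleftrightarrow> (\<exists>N. real_distribution N \<and> F = cdf N)"

(* Extended-real valued: at the endpoints u = 0 and u = 1 the value may be infinite
   (the infimum over the empty set is \<infinity>). For a cdf F and 0 < u < 1 the value is finite. *)
definition quantile :: "(real \<Rightarrow> real) \<Rightarrow> real \<Rightarrow> ereal" where
  "quantile F u =
    (if u = 0 then Lim (at_right 0) (\<lambda>v. Inf (ereal ` {x. v \<le> F x}))
     else Inf (ereal ` {x. u \<le> F x}))"

(* The quantile function is bounded above on each interval (0, p] with p < 1, so its
   integral over (0, p) exists in [-\<infinity>, \<infinity>), and it is finite iff the function is integrable.
   real_of_ereal only replaces values at the endpoints, which do not affect the integral. *)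
definition F1_minus :: "(real \<Rightarrow> real) set" where
  "F1_minus = {F. is_cdf F \<and>
     (\<forall>p\<in>{0<..<1}. interval_lebesgue_integrable lborel 0 (ereal p)
        (\<lambda>u. real_of_ereal (quantile F u)))}"

definition random_cdf :: "'a measure \<Rightarrow> ('a \<Rightarrow> real \<Rightarrow> real) \<Rightarrow> bool" where
  "random_cdf M G \<longleftrightarrow>
     (\<lambda>(\<omega>, x). G \<omega> x) \<in> borel_measurable (M \<Otimes>\<^sub>M borel) \<and>
     (\<forall>\<omega>\<in>space M. \<forall>x. G \<omega> x \<in> {0..1}) \<and>
     (AE \<omega> in M. is_cdf (G \<omega>))"

(* Convergence in probability to a constant. The random variables considered here are built
   from functions that are cdfs only for almost all \<omega>, so they are meaningful, and measurable,
   only up to a null set. Hence the completion of M; otherwise an exceptional null set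
   could make an event non-measurable, and its measure would be 0 by convention. *)
definition conv_in_prob :: "'a measure \<Rightarrow> (nat \<Rightarrow> 'a \<Rightarrow> real) \<Rightarrow> real \<Rightarrow> bool" where
  "conv_in_prob M X c \<longleftrightarrow>
     (\<forall>n. X n \<in> borel_measurable (completion M)) \<and>
     (\<forall>\<epsilon>>0. (\<lambda>n. measure (completion M) {\<omega>\<in>space M. \<epsilon> < \<bar>X n \<omega> - c\<bar>}) \<longlonglongrightarrow> 0)"

(* The measurability conjunct of conv_in_prob is automatic for the sup distance. *)
lemma sup_distance_measurable:
  fixes G :: "'a \<Rightarrow> real \<Rightarrow> real" and F :: "real \<Rightarrow> real"
  assumes G: "random_cdf M G" and F: "is_cdf F"
  shows "(\<lambda>\<omega>. SUP x. \<bar>G \<omega> x - F x\<bar>) \<in> borel_measurable (completion M)"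
proof -
  have rc: "continuous (at_right x) H" if "is_cdf H" for H x
    using that finite_borel_measure.cdf_is_right_cont real_distribution.finite_borel_measure_M
    unfolding is_cdf_def by blast
  have rng: "0 \<le> H x \<and> H x \<le> 1" if "is_cdf H" for H x
    using that finite_borel_measure.cdf_nonneg real_distribution.finite_borel_measure_M
      real_distribution.cdf_bounded_prob
    unfolding is_cdf_def by blast
  have sup_eq: "(SUP x. \<bar>H x - F x\<bar>) = (SUP x\<in>\<rat>. \<bar>H x - F x\<bar>)" if H: "is_cdf H" for H
  proof (rule antisym)
    have bd: "\<bar>H x - F x\<bar> \<le> 1" for x
      using rng[OF H, of x] rng[OF F, of x] by auto
    have bdd: "bdd_above ((\<lambda>x. \<bar>H x - F x\<bar>) ` A)" for A
      using bd by (intro bdd_aboveI[of _ 1]) auto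
    show "(SUP x\<in>\<rat>. \<bar>H x - F x\<bar>) \<le> (SUP x. \<bar>H x - F x\<bar>)"
      by (intro cSUP_subset_mono bdd) (auto intro: exI[of _ 0])
    show "(SUP x. \<bar>H x - F x\<bar>) \<le> (SUP x\<in>\<rat>. \<bar>H x - F x\<bar>)"
    proof (rule cSUP_least)
      fix x :: real
      have "continuous (at_right x) (\<lambda>y. \<bar>H y - F y\<bar>)"
        by (intro continuous_intros rc H F)
      then have lim: "((\<lambda>y. \<bar>H y - F y\<bar>) \<longlongrightarrow> \<bar>H x - F x\<bar>) (at_right x)"
        by (simp add: continuous_within)
      show "\<bar>H x - F x\<bar> \<le> (SUP x\<in>\<rat>. \<bar>H x - F x\<bar>)"
      proof (rule ccontr)
        assume "\<not> ?thesis"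
        then have "\<forall>\<^sub>F y in at_right x. (SUP x\<in>\<rat>. \<bar>H x - F x\<bar>) < \<bar>H y - F y\<bar>"
          using order_tendstoD(1)[OF lim] by auto
        then obtain b where b: "b > x"
          "\<And>y. y > x \<Longrightarrow> y < b \<Longrightarrow> (SUP x\<in>\<rat>. \<bar>H x - F x\<bar>) < \<bar>H y - F y\<bar>"
          unfolding eventually_at_right_field by blast
        obtain q where "q \<in> \<rat>" "x < q" "q < b"
          using Rats_dense_in_real b(1) by blast
        then show False
          using b(2)[of q] cSUP_upper[OF _ bdd, of q \<rat>] by fastforce
      qed
    qed simp
  qed
  have Gx [measurable]: "(\<lambda>\<omega>. G \<omega> x) \<in> borel_measurable M" for x
    using G measurable_Pair1[of "\<lambda>(\<omega>, x). G \<omega> x" M borel borel x]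
    unfolding random_cdf_def by simp
  have "(\<lambda>\<omega>. SUP x\<in>\<rat>. \<bar>G \<omega> x - F x\<bar>) \<in> borel_measurable M"
  proof (rule borel_measurable_cSUP)
    show "bdd_above ((\<lambda>x. \<bar>G \<omega> x - F x\<bar>) ` \<rat>)" if "\<omega> \<in> space M" for \<omega>
    proof (rule bdd_aboveI[of _ 1])
      fix y assume "y \<in> (\<lambda>x. \<bar>G \<omega> x - F x\<bar>) ` \<rat>"
      then obtain x where "y = \<bar>G \<omega> x - F x\<bar>" by blast
      then show "y \<le> 1"
        using G that rng[OF F, of x] unfolding random_cdf_def
        by (smt (verit) atLeastAtMost_iff)
    qed
  qed (use countable_rat in auto)
  then obtain g where g: "g = (\<lambda>\<omega>. SUP x\<in>\<rat>. \<bar>G \<omega> x - F x\<bar>)" "g \<in> borel_measurable M"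
    by blast
  have AE: "AE \<omega> in completion M. g \<omega> = (SUP x. \<bar>G \<omega> x - F x\<bar>)"
    using G unfolding random_cdf_def AE_completion_iff
    by (auto simp: g(1) sup_eq elim!: eventually_mono)
  show ?thesis
    unfolding borel_measurable_iff_le
  proof
    fix a
    show "{\<omega> \<in> space (completion M). (SUP x. \<bar>G \<omega> x - F x\<bar>) \<le> a} \<in> sets (completion M)"
    proof (rule completion.in_sets_AE)
      show "{\<omega> \<in> space M. g \<omega> \<le> a} \<in> sets (completion M)"
        using g(2) by (intro sets_completionI_sets) measurable
      show "AE \<omega> in completion M. \<omega> \<in> {\<omega> \<in> space M. g \<omega> \<le> a} \<longleftrightarrow>
          \<omega> \<in> {\<omega> \<in> space (completion M). (SUP x. \<bar>G \<omega> x - F x\<bar>) \<le> a}"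
        using AE by eventually_elim auto
    qed auto
  qed
qed

end

theory Submission
  imports Defs
begin

text \<open>
  Fubini's theorem turns the integral of the quantile function of any cdf \<open>H\<close> into
  \<open>a p - \<integral>\<^sub>x\<^sub><\<^sub>a H x + R H\<close>, where \<open>a\<close> is an arbitrary cut point and \<open>R H \<ge> 0\<close> integrates the
  positive part of \<open>H - p\<close> to the left of \<open>a\<close> and that of \<open>p - H\<close> to the right of \<open>a\<close>. For the
  cut point \<open>a = F\<inverse>(p)\<close> the remainder of \<open>F\<close> vanishes. If \<open>H\<close> is uniformly \<open>\<delta>\<close>-close to \<open>F\<close> for
  some \<open>\<delta> \<le> \<eta>\<close>, then both integrands are at most \<open>\<delta>\<close> and vanish outside the fixed interval
  \<open>[F\<inverse>(p - \<eta>), F\<inverse>(p + \<eta>)]\<close>, so that the remainder is at most \<open>\<delta>\<close> times its length.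
\<close>

section \<open>Quantiles\<close>

text \<open>This gives access to the pseudoinverse \<open>I u\<close> of a right-continuous monotone
  function, for which \<open>u \<le> H x\<close> is equivalent to \<open>I u \<le> x\<close> when
  \<open>0 < u < 1\<close>.\<close>

lemma is_cdf_right_continuous_mono:
  assumes "is_cdf H"
  shows "right_continuous_mono H 0 1"
proof -
  obtain N where N: "real_distribution N" "H = cdf N"
    using assms unfolding is_cdf_def by blast
  interpret real_distribution N by (rule N(1))
  have "cdf_distribution N"
    by (simp add: cdf_distribution_def N(1))
  then interpret cdf_distribution N .
  show ?thesis
    unfolding N(2) by unfold_locales
qed

lemma is_cdf_bounds:
  assumes "is_cdf H"
  shows "0 \<le> H x" "H x \<le> 1"
proof -
  obtain N where N: "real_distribution N" "H = cdf N"
    using assms unfolding is_cdf_def by blast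
  interpret real_distribution N by (rule N(1))
  show "0 \<le> H x" "H x \<le> 1"
    unfolding N(2) by (rule cdf_nonneg, rule cdf_bounded_prob)
qed

lemma is_cdf_mono: "is_cdf H \<Longrightarrow> mono H"
  by (rule right_continuous_mono.mono[OF is_cdf_right_continuous_mono])

lemma is_cdf_borel_measurable: "is_cdf H \<Longrightarrow> H \<in> borel_measurable borel"
  by (intro borel_measurable_mono is_cdf_mono)

text \<open>By the pseudoinverse equivalence \<open>I u\<close> is the least element of the set. The
  set is therefore nonempty and bounded below, so its infima in the reals and in the extended reals
  agree.\<close>

lemma quantile_eq_ereal_Inf:
  assumes "is_cdf H" "0 < u" "u < 1"
  shows "quantile H u = ereal (Inf {x. u \<le> H x})"
proof -
  interpret right_continuous_mono H 0 1
    by (rule is_cdf_right_continuous_mono) fact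
  have "u \<le> H (I u)"
    using pseudoinverse[OF assms(2,3), of "I u"] by simp
  moreover have "I u \<le> x" if "u \<le> H x" for x
    using pseudoinverse[OF assms(2,3), of x] that by simp
  ultimately have "ereal (I u) = Inf (ereal ` {x. u \<le> H x})"
    by (intro ereal_Inf' bdd_belowI[of _ "I u"]) auto
  then show ?thesis
    using assms by (simp add: quantile_def)
qed

text \<open>The Galois connection between quantile function and cdf. The integral formulas below are
  proved for any \<open>g\<close> satisfying it.\<close>

lemma quantile_le_iff:
  assumes "is_cdf H" "0 < u" "u < 1"
  shows "real_of_ereal (quantile H u) \<le> x \<longleftrightarrow> u \<le> H x"
  unfolding quantile_eq_ereal_Inf[OF assms] real_of_ereal.simps
  by (rule right_continuous_mono.pseudoinverse[OF is_cdf_right_continuous_mono[OF assms(1)]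
        assms(2,3), symmetric])

lemma ereal_real_quantile:
  assumes "is_cdf H" "0 < u" "u < 1"
  shows "ereal (real_of_ereal (quantile H u)) = quantile H u"
  by (simp add: quantile_eq_ereal_Inf[OF assms])

section \<open>Integrals of generalized inverses\<close>

lemma nn_integral_inverse_below:
  fixes g H :: "real \<Rightarrow> real"
  assumes [measurable]: "H \<in> borel_measurable borel"
    and nn: "\<And>x. 0 \<le> H x" and p: "0 < p"
    and g: "\<And>u x. 0 < u \<Longrightarrow> u < p \<Longrightarrow> g u \<le> x \<longleftrightarrow> u \<le> H x"
  shows "(\<integral>\<^sup>+u. ennreal (indicator {0<..<p} u * max 0 (a - g u)) \<partial>lborel) =
    (\<integral>\<^sup>+x. ennreal (indicator {..<a} x * min (H x) p) \<partial>lborel)"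
proof -
  \<comment> \<open>The region is described through \<open>H\<close>, whose measurability is given.
    By the Galois connection its section at \<open>u\<close> is \<open>[g u, a)\<close>, while its
    section at \<open>x < a\<close> is \<open>(0, H x]\<close> or \<open>(0, p)\<close>. Tonelli
    equates the integrals of the two lengths.\<close>
  define S where "S = {(u, x). 0 < u \<and> u < p \<and> u \<le> H x \<and> x < a}"
  have S [measurable]: "S \<in> sets (borel \<Otimes>\<^sub>M borel)"
  proof -
    have "{z \<in> space (borel \<Otimes>\<^sub>M borel). 0 < fst z \<and> fst z < p \<and> fst z \<le> H (snd z) \<and> snd z < a}
        \<in> sets (borel \<Otimes>\<^sub>M borel)"
      by measurable
    also have "{z \<in> space (borel \<Otimes>\<^sub>M borel). 0 < fst z \<and> fst z < p \<and> fst z \<le> H (snd z) \<and> snd z < a} = S"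
      by (auto simp: S_def space_pair_measure)
    finally show ?thesis .
  qed
  have "ennreal (indicator {0<..<p} u * max 0 (a - g u)) = (\<integral>\<^sup>+x. indicator S (u, x) \<partial>lborel)" for u
  proof -
    have "(\<integral>\<^sup>+x. indicator S (u, x) \<partial>lborel) =
        (\<integral>\<^sup>+x. indicator (if u \<in> {0<..<p} then {g u..<a} else {}) x \<partial>lborel)"
      by (intro nn_integral_cong) (auto simp: S_def indicator_def g)
    also have "\<dots> = ennreal (indicator {0<..<p} u * max 0 (a - g u))"
      by (cases "g u \<le> a") (auto simp: max_def)
    finally show ?thesis ..
  qed
  moreover have "ennreal (indicator {..<a} x * min (H x) p) = (\<integral>\<^sup>+u. indicator S (u, x) \<partial>lborel)" for x
  proof -
    have "(\<integral>\<^sup>+u. indicator S (u, x) \<partial>lborel) =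
        (\<integral>\<^sup>+u. indicator (if x < a then if H x < p then {0<..H x} else {0<..<p} else {}) u \<partial>lborel)"
      by (intro nn_integral_cong) (auto simp: S_def indicator_def)
    also have "\<dots> = ennreal (indicator {..<a} x * min (H x) p)"
      using nn[of x] p by (auto simp: min_def)
    finally show ?thesis ..
  qed
  ultimately show ?thesis
    using lborel_pair.Fubini'[of "\<lambda>u x. indicator S (u, x)"] by simp
qed

text \<open>The counterpart to the right of \<open>a\<close>: negating the Galois connection turns
  \<open>H x < u\<close> into \<open>x < g u\<close>, so the sections become \<open>[a, g u)\<close>
  and \<open>(H x, p)\<close>.\<close>

lemma nn_integral_inverse_above:
  fixes g H :: "real \<Rightarrow> real"
  assumes [measurable]: "H \<in> borel_measurable borel"
    and nn: "\<And>x. 0 \<le> H x"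
    and g: "\<And>u x. 0 < u \<Longrightarrow> u < p \<Longrightarrow> g u \<le> x \<longleftrightarrow> u \<le> H x"
  shows "(\<integral>\<^sup>+u. ennreal (indicator {0<..<p} u * max 0 (g u - a)) \<partial>lborel) =
    (\<integral>\<^sup>+x. ennreal (indicator {a..} x * max 0 (p - H x)) \<partial>lborel)"
proof -
  define S where "S = {(u, x). 0 < u \<and> u < p \<and> H x < u \<and> a \<le> x}"
  have S [measurable]: "S \<in> sets (borel \<Otimes>\<^sub>M borel)"
  proof -
    have "{z \<in> space (borel \<Otimes>\<^sub>M borel). 0 < fst z \<and> fst z < p \<and> H (snd z) < fst z \<and> a \<le> snd z}
        \<in> sets (borel \<Otimes>\<^sub>M borel)"
      by measurable
    also have "{z \<in> space (borel \<Otimes>\<^sub>M borel). 0 < fst z \<and> fst z < p \<and> H (snd z) < fst z \<and> a \<le> snd z} = S"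
      by (auto simp: S_def space_pair_measure)
    finally show ?thesis .
  qed
  have "ennreal (indicator {0<..<p} u * max 0 (g u - a)) = (\<integral>\<^sup>+x. indicator S (u, x) \<partial>lborel)" for u
  proof -
    have "(\<integral>\<^sup>+x. indicator S (u, x) \<partial>lborel) =
        (\<integral>\<^sup>+x. indicator (if u \<in> {0<..<p} then {a..<g u} else {}) x \<partial>lborel)"
      by (intro nn_integral_cong)
        (auto simp: S_def indicator_def g simp flip: not_le)
    also have "\<dots> = ennreal (indicator {0<..<p} u * max 0 (g u - a))"
      by (cases "a \<le> g u") (auto simp: max_def)
    finally show ?thesis ..
  qed
  moreover have "ennreal (indicator {a..} x * max 0 (p - H x)) = (\<integral>\<^sup>+u. indicator S (u, x) \<partial>lborel)" for x
  proof -
    have "(\<integral>\<^sup>+u. indicator S (u, x) \<partial>lborel) =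
        (\<integral>\<^sup>+u. indicator (if a \<le> x then {H x<..<p} else {}) u \<partial>lborel)"
      \<comment> \<open>Nonnegativity of \<open>H\<close> makes the constraint \<open>0 < u\<close>
        a consequence of \<open>H x < u\<close>.\<close>
      using nn[of x] by (intro nn_integral_cong) (auto simp: S_def indicator_def)
    also have "\<dots> = ennreal (indicator {a..} x * max 0 (p - H x))"
      by (cases "H x \<le> p") (auto simp: max_def)
    finally show ?thesis ..
  qed
  ultimately show ?thesis
    using lborel_pair.Fubini'[of "\<lambda>u x. indicator S (u, x)"] by simp
qed

text \<open>Split \<open>g\<close> on \<open>(0, p)\<close> as \<open>a\<close> minus the positive
  part of \<open>a - g\<close> plus the positive part of \<open>g - a\<close>, and evaluate both
  parts by Tonelli. Integrability of \<open>g\<close> makes both finite.\<close>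

lemma integral_inverse:
  fixes g H :: "real \<Rightarrow> real"
  assumes [measurable]: "H \<in> borel_measurable borel"
    and nn: "\<And>x. 0 \<le> H x" and p: "0 < p"
    and g: "\<And>u x. 0 < u \<Longrightarrow> u < p \<Longrightarrow> g u \<le> x \<longleftrightarrow> u \<le> H x"
    and int: "set_integrable lborel {0<..<p} g"
  shows "set_integrable lborel {..<a} (\<lambda>x. min (H x) p)"
    and "(LBINT u:{0<..<p}. g u) =
      a * p - (LBINT x:{..<a}. min (H x) p) + (LBINT x:{a..}. max 0 (p - H x))"
proof -
  note below = nn_integral_inverse_below[where g=g and H=H and p=p and a=a, OF assms(1) nn p g]
  note above = nn_integral_inverse_above[where g=g and H=H and p=p and a=a, OF assms(1) nn g]
  let ?L = "\<lambda>u. indicator {0<..<p} u * max 0 (a - g u)"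
  let ?U = "\<lambda>u. indicator {0<..<p} u * max 0 (g u - a)"
  have ia: "set_integrable lborel {0<..<p} (\<lambda>u. a)"
    unfolding set_integrable_def
    by (intro integrable_scaleR_left integrable_real_indicator) (use p in auto)
  \<comment> \<open>With the indicator inside the maximum, both functions are positive parts of
    integrable functions.\<close>
  have L: "?L = (\<lambda>u. max 0 (indicator {0<..<p} u *\<^sub>R (a - g u)))"
    and U: "?U = (\<lambda>u. max 0 (indicator {0<..<p} u *\<^sub>R (g u - a)))"
    by (auto simp: indicator_def)
  have iL: "integrable lborel ?L"
    unfolding L using set_integral_diff(1)[OF ia int] by (simp add: set_integrable_def)
  have iU: "integrable lborel ?U"
    unfolding U using set_integral_diff(1)[OF int ia] by (simp add: set_integrable_def)
  have *: "(\<integral>\<^sup>+x. ennreal (indicator {..<a} x * min (H x) p) \<partial>lborel) < \<infinity>"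
  proof -
    have "(\<integral>\<^sup>+u. ennreal (?L u) \<partial>lborel) = ennreal (integral\<^sup>L lborel ?L)"
      by (intro nn_integral_eq_integral iL) simp
    then show ?thesis
      by (simp add: below)
  qed
  show "set_integrable lborel {..<a} (\<lambda>x. min (H x) p)"
    unfolding set_integrable_def
    by (rule integrableI_nonneg) (use nn p * in auto)
  have eqL: "integral\<^sup>L lborel ?L = (LBINT x:{..<a}. min (H x) p)"
    unfolding set_lebesgue_integral_def
    using iL nn p by (simp add: integral_eq_nn_integral below)
  have eqU: "integral\<^sup>L lborel ?U = (LBINT x:{a..}. max 0 (p - H x))"
    unfolding set_lebesgue_integral_def
    using iU by (simp add: integral_eq_nn_integral above)
  have "(LBINT u:{0<..<p}. g u) =
      integral\<^sup>L lborel (\<lambda>u. indicator {0<..<p} u * a - ?L u + ?U u)"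
    unfolding set_lebesgue_integral_def
    by (intro Bochner_Integration.integral_cong) (auto simp: indicator_def)
  also have "\<dots> = integral\<^sup>L lborel (\<lambda>u. indicator {0<..<p} u * a) - integral\<^sup>L lborel ?L + integral\<^sup>L lborel ?U"
    using ia iL iU by (simp add: set_integrable_def)
  also have "integral\<^sup>L lborel (\<lambda>u. indicator {0<..<p} u * a) = a * p"
    using p by simp
  finally show "(LBINT u:{0<..<p}. g u) =
      a * p - (LBINT x:{..<a}. min (H x) p) + (LBINT x:{a..}. max 0 (p - H x))"
    unfolding eqL eqU .
qed

section \<open>The remainder\<close>

text \<open>The area by which \<open>H\<close> lies on the wrong side of the level \<open>p\<close>:
  above it before \<open>a\<close>, below it from \<open>a\<close> on.\<close>

definition quantile_remainder :: "real \<Rightarrow> real \<Rightarrow> (real \<Rightarrow> real) \<Rightarrow> real" where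
  "quantile_remainder a p H =
    (LBINT x:{..<a}. max 0 (H x - p)) + (LBINT x:{a..}. max 0 (p - H x))"

lemma quantile_remainder_nonneg: "0 \<le> quantile_remainder a p H"
  unfolding quantile_remainder_def set_lebesgue_integral_def
  by (intro add_nonneg_nonneg Bochner_Integration.integral_nonneg) simp_all

lemma
  fixes p a :: real
  assumes H: "H \<in> F1_minus" and p: "0 < p" "p < 1"
  shows F1_minus_integrable: "set_integrable lborel {..<a} H"
    and F1_minus_integral: "(LBINT u=0..p. real_of_ereal (quantile H u)) =
      a * p - (LBINT x:{..<a}. H x) + quantile_remainder a p H"
proof -
  have cdf: "is_cdf H"
    using H by (simp add: F1_minus_def)
  note [measurable] = is_cdf_borel_measurable[OF cdf]
  have ei: "einterval 0 (ereal p) = {0<..<p}"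
    by (auto simp: einterval_iff zero_ereal_def)
  have "interval_lebesgue_integrable lborel 0 (ereal p) (\<lambda>u. real_of_ereal (quantile H u))"
    using H p by (simp add: F1_minus_def)
  then have int: "set_integrable lborel {0<..<p} (\<lambda>u. real_of_ereal (quantile H u))"
    using p by (simp add: interval_lebesgue_integrable_def ei)
  note * = integral_inverse[where a=a and g="\<lambda>u. real_of_ereal (quantile H u)" and H=H and p=p,
      OF is_cdf_borel_measurable[OF cdf] is_cdf_bounds(1)[OF cdf] p(1) _ int]
  have min_int: "set_integrable lborel {..<a} (\<lambda>x. min (H x) p)"
    using p by (intro *) (auto simp: quantile_le_iff[OF cdf])
  have eq: "(LBINT u:{0<..<p}. real_of_ereal (quantile H u)) =
      a * p - (LBINT x:{..<a}. min (H x) p) + (LBINT x:{a..}. max 0 (p - H x))"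
    using p by (intro *) (auto simp: quantile_le_iff[OF cdf])
  show H_int: "set_integrable lborel {..<a} H"
  \<comment> \<open>The truncation divided by \<open>p\<close> dominates \<open>H\<close>: it is
    \<open>H x / p\<close> where \<open>H x \<le> p\<close>, and 1 elsewhere.\<close>
  proof (rule set_integrable_bound)
    show "set_integrable lborel {..<a} (\<lambda>x. min (H x) p / p)"
      using min_int by simp
    show "set_borel_measurable lborel {..<a} H"
      unfolding set_borel_measurable_def by measurable
    have "norm (H x) \<le> norm (min (H x) p / p)" for x
    proof (cases "H x \<le> p")
      case True
      then show ?thesis
        using p is_cdf_bounds[OF cdf, of x] by (simp add: field_simps mult_left_le mult_left_le_one_le)
    qed (use p is_cdf_bounds[OF cdf, of x] in simp)
    then show "AE x in lborel. x \<in> {..<a} \<longrightarrow> norm (H x) \<le> norm (min (H x) p / p)"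
      by simp
  qed
  \<comment> \<open>Replacing the truncated integral by that of \<open>H\<close> costs the excess of
    \<open>H\<close> over \<open>p\<close>, which is the left half of the remainder.\<close>
  have "(LBINT x:{..<a}. max 0 (H x - p)) = (LBINT x:{..<a}. H x - min (H x) p)"
    by (intro set_lebesgue_integral_cong) (auto simp: max_def min_def)
  also have "\<dots> = (LBINT x:{..<a}. H x) - (LBINT x:{..<a}. min (H x) p)"
    by (intro set_integral_diff H_int min_int)
  finally show "(LBINT u=0..p. real_of_ereal (quantile H u)) =
      a * p - (LBINT x:{..<a}. H x) + quantile_remainder a p H"
    using eq p by (simp add: interval_lebesgue_integral_def ei quantile_remainder_def)
qed

lemma quantile_remainder_bound:
  assumes F: "is_cdf F" and p: "0 < p - \<eta>" "p + \<eta> < 1" and \<delta>: "0 \<le> \<delta>" "\<delta> \<le> \<eta>"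
    and close: "\<And>x. \<bar>H x - F x\<bar> \<le> \<delta>"
  shows "quantile_remainder (real_of_ereal (quantile F p)) p H \<le>
    \<delta> * (real_of_ereal (quantile F (p + \<eta>)) - real_of_ereal (quantile F (p - \<eta>)))"
proof -
  define a c d where "a = real_of_ereal (quantile F p)"
    and "c = real_of_ereal (quantile F (p - \<eta>))" and "d = real_of_ereal (quantile F (p + \<eta>))"
  have iff: "a \<le> x \<longleftrightarrow> p \<le> F x" "c \<le> x \<longleftrightarrow> p - \<eta> \<le> F x" "d \<le> x \<longleftrightarrow> p + \<eta> \<le> F x" for x
    unfolding a_def c_def d_def using p \<delta> by (simp_all add: quantile_le_iff[OF F])
  have ca: "c \<le> a" and ad: "a \<le> d"
    using iff(1)[of a] iff(2)[of a] iff(1)[of d] iff(3)[of d] \<delta> by auto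
  have int: "integrable lborel (\<lambda>x. indicator {y..<z} x *\<^sub>R \<delta>)" for y z :: real
    by (intro integrable_scaleR_left integrable_real_indicator) (cases "y \<le> z"; simp)+
  have "(LBINT x:{..<a}. max 0 (H x - p)) \<le> (LBINT x:{c..<a}. \<delta>)"
    unfolding set_lebesgue_integral_def
  \<comment> \<open>Only the dominating function has to be integrable here: a non-integrable
    integrand has integral 0, and the bound is nonnegative.\<close>
  proof (rule integral_mono')
    \<comment> \<open>For \<open>x < c\<close>, \<open>F x < p - \<eta>\<close> forces
      \<open>H x < p\<close>; for \<open>c \<le> x < a\<close>, \<open>F x < p\<close> leaves an
      excess of at most \<open>\<delta>\<close>.\<close>
    show "indicator {..<a} x *\<^sub>R max 0 (H x - p) \<le> indicator {c..<a} x *\<^sub>R \<delta>" for x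
      using iff(1,2)[of x] close[of x] \<delta> by (auto simp: indicator_def)
  qed (rule int, use \<delta> in simp)
  also have "\<dots> = \<delta> * (a - c)"
    using ca by (simp add: set_lebesgue_integral_def)
  finally have 1: "(LBINT x:{..<a}. max 0 (H x - p)) \<le> \<delta> * (a - c)" .
  have "(LBINT x:{a..}. max 0 (p - H x)) \<le> (LBINT x:{a..<d}. \<delta>)"
    unfolding set_lebesgue_integral_def
  proof (rule integral_mono')
    \<comment> \<open>For \<open>x \<ge> d\<close>, \<open>F x \<ge> p + \<eta>\<close> forces
      \<open>H x \<ge> p\<close>; on \<open>[a, d)\<close>, \<open>F x \<ge> p\<close> leaves a
      deficit of at most \<open>\<delta>\<close>.\<close>
    show "indicator {a..} x *\<^sub>R max 0 (p - H x) \<le> indicator {a..<d} x *\<^sub>R \<delta>" for x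
      using iff(1,3)[of x] close[of x] \<delta> by (auto simp: indicator_def)
  qed (rule int, use \<delta> in simp)
  also have "\<dots> = \<delta> * (d - a)"
    using ad by (simp add: set_lebesgue_integral_def)
  finally have 2: "(LBINT x:{a..}. max 0 (p - H x)) \<le> \<delta> * (d - a)" .
  show ?thesis
    using 1 2 unfolding quantile_remainder_def a_def[symmetric] c_def[symmetric] d_def[symmetric]
    by (simp add: algebra_simps)
qed

text \<open>The bound with \<open>\<eta> = \<delta> = 0\<close> is zero.\<close>

lemma quantile_remainder_self:
  assumes F: "is_cdf F" and p: "0 < p" "p < 1"
  shows "quantile_remainder (real_of_ereal (quantile F p)) p F = 0"
  using quantile_remainder_bound[OF F, of p 0 0 F] quantile_remainder_nonneg p
  by (intro antisym) auto

text \<open>Subtracting the two integral formulas cancels \<open>a * p\<close>, and the remainder of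
  \<open>F\<close> vanishes at its own quantile. The error term of the expansion is thus exactly the
  remainder of \<open>H\<close>.\<close>

lemma F1_minus_integral_diff:
  fixes p :: real
  assumes F: "F \<in> F1_minus" and H: "H \<in> F1_minus" and p: "0 < p" "p < 1"
  defines "a \<equiv> real_of_ereal (quantile F p)"
  shows "(LBINT u=0..p. real_of_ereal (quantile H u)) - (LBINT u=0..p. real_of_ereal (quantile F u)) =
    (LBINT x:{..<a}. F x - H x) + quantile_remainder a p H"
proof -
  have "quantile_remainder a p F = 0"
    using F p by (simp add: a_def quantile_remainder_self F1_minus_def)
  then show ?thesis
    using F1_minus_integral[OF F p, of a] F1_minus_integral[OF H p, of a]
      set_integral_diff(2)[OF F1_minus_integrable[OF F p] F1_minus_integrable[OF H p], of a]
    by simp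
qed

section \<open>Convergence in probability\<close>

lemma borel_measurable_completion_cong_AE:
  fixes f g :: "'a \<Rightarrow> real"
  assumes f: "f \<in> borel_measurable (completion M)" and AE: "AE \<omega> in M. f \<omega> = g \<omega>"
  shows "g \<in> borel_measurable (completion M)"
  unfolding borel_measurable_iff_le
proof
  fix a
  show "{\<omega> \<in> space (completion M). g \<omega> \<le> a} \<in> sets (completion M)"
  proof (rule completion.in_sets_AE)
    show "{\<omega> \<in> space (completion M). f \<omega> \<le> a} \<in> sets (completion M)"
      using f by measurable
    show "AE \<omega> in completion M. \<omega> \<in> {\<omega> \<in> space (completion M). f \<omega> \<le> a} \<longleftrightarrow>
        \<omega> \<in> {\<omega> \<in> space (completion M). g \<omega> \<le> a}"
      using AE_completion[OF AE] by eventually_elim auto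
  qed auto
qed

text \<open>Up to a null set, each deviation event of \<open>Y\<close> is covered by two events
  whose probabilities tend to 0. The threshold \<open>\<eta>\<close> may depend on
  \<open>\<epsilon>\<close> but not on \<open>n\<close>. A single dominating sequence can be passed
  twice.\<close>

lemma conv_in_prob_dominated:
  assumes M: "prob_space M"
    and Y: "\<And>n. Y n \<in> borel_measurable (completion M)"
    and X: "conv_in_prob M X a" and Z: "conv_in_prob M Z b"
    and dom: "\<And>\<epsilon>. \<epsilon> > 0 \<Longrightarrow> \<exists>\<eta>>0. \<forall>n. AE \<omega> in M.
      \<epsilon> < \<bar>Y n \<omega> - c\<bar> \<longrightarrow> \<eta> < \<bar>X n \<omega> - a\<bar> \<or> \<eta> < \<bar>Z n \<omega> - b\<bar>"
  shows "conv_in_prob M Y c"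
  unfolding conv_in_prob_def
proof (intro conjI allI impI)
  fix \<epsilon> :: real assume "\<epsilon> > 0"
  then obtain \<eta> where \<eta>: "\<eta> > 0" "\<And>n. AE \<omega> in M.
      \<epsilon> < \<bar>Y n \<omega> - c\<bar> \<longrightarrow> \<eta> < \<bar>X n \<omega> - a\<bar> \<or> \<eta> < \<bar>Z n \<omega> - b\<bar>"
    using dom by blast
  interpret prob_space M by fact
  interpret C: finite_measure "completion M"
    by (rule finite_measureI) (simp add: emeasure_space_1)
  note [measurable] = Y
  have [measurable]: "X n \<in> borel_measurable (completion M)" "Z n \<in> borel_measurable (completion M)" for n
    using X Z by (auto simp: conv_in_prob_def)
  let ?P = "measure (completion M)"
  let ?A = "\<lambda>n. {\<omega> \<in> space (completion M). \<eta> < \<bar>X n \<omega> - a\<bar>}"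
  let ?B = "\<lambda>n. {\<omega> \<in> space (completion M). \<eta> < \<bar>Z n \<omega> - b\<bar>}"
  have AB: "?A n \<in> sets (completion M)" "?B n \<in> sets (completion M)" for n
    by measurable
  have le: "?P {\<omega> \<in> space (completion M). \<epsilon> < \<bar>Y n \<omega> - c\<bar>} \<le> ?P (?A n) + ?P (?B n)" for n
  proof -
    have "?P {\<omega> \<in> space (completion M). \<epsilon> < \<bar>Y n \<omega> - c\<bar>} \<le> ?P (?A n \<union> ?B n)"
      using AE_completion[OF \<eta>(2)[of n]] by (intro C.finite_measure_mono_AE sets.Un AB) auto
    also have "\<dots> \<le> ?P (?A n) + ?P (?B n)"
      by (rule measure_Un_le[OF AB])
    finally show ?thesis .
  qed
  have "(\<lambda>n. ?P (?A n) + ?P (?B n)) \<longlonglongrightarrow> 0 + 0"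
    using X Z \<eta>(1) by (intro tendsto_add) (auto simp: conv_in_prob_def)
  then have lim: "(\<lambda>n. ?P (?A n) + ?P (?B n)) \<longlonglongrightarrow> 0" by simp
  show "(\<lambda>n. ?P {\<omega> \<in> space M. \<epsilon> < \<bar>Y n \<omega> - c\<bar>}) \<longlonglongrightarrow> 0"
  proof (rule tendsto_sandwich[OF _ _ tendsto_const lim])
    show "\<forall>\<^sub>F n in sequentially. ?P {\<omega> \<in> space M. \<epsilon> < \<bar>Y n \<omega> - c\<bar>} \<le> ?P (?A n) + ?P (?B n)"
      using le by (intro always_eventually allI) simp
  qed simp
qed (rule Y)

lemma conv_in_prob_cong_AE:
  assumes M: "prob_space M" and X: "conv_in_prob M X c" and AE: "\<And>n. AE \<omega> in M. X n \<omega> = Y n \<omega>"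
  shows "conv_in_prob M Y c"
proof (rule conv_in_prob_dominated[OF M _ X X])
  show "Y n \<in> borel_measurable (completion M)" for n
    using X by (intro borel_measurable_completion_cong_AE[OF _ AE]) (simp add: conv_in_prob_def)
  show "\<exists>\<eta>>0. \<forall>n. AE \<omega> in M. \<epsilon> < \<bar>Y n \<omega> - c\<bar> \<longrightarrow> \<eta> < \<bar>X n \<omega> - c\<bar> \<or> \<eta> < \<bar>X n \<omega> - c\<bar>"
    if "\<epsilon> > 0" for \<epsilon>
  proof (intro exI[of _ \<epsilon>] conjI allI)
    fix n
    show "AE \<omega> in M. \<epsilon> < \<bar>Y n \<omega> - c\<bar> \<longrightarrow> \<epsilon> < \<bar>X n \<omega> - c\<bar> \<or> \<epsilon> < \<bar>X n \<omega> - c\<bar>"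
      using AE[of n] by eventually_elim simp
  qed (rule that)
qed

text \<open>Used for both directions of the equivalence, with the remainder as one of the two
  dominating sequences.\<close>

lemma conv_in_prob_triangle:
  assumes M: "prob_space M" and X: "conv_in_prob M X a" and Z: "conv_in_prob M Z b"
    and Y: "\<And>n. Y n \<in> borel_measurable (completion M)"
    and le: "\<And>n. AE \<omega> in M. \<bar>Y n \<omega> - c\<bar> \<le> \<bar>X n \<omega> - a\<bar> + \<bar>Z n \<omega> - b\<bar>"
  shows "conv_in_prob M Y c"
proof (rule conv_in_prob_dominated[OF M Y X Z])
  show "\<exists>\<eta>>0. \<forall>n. AE \<omega> in M. \<epsilon> < \<bar>Y n \<omega> - c\<bar> \<longrightarrow> \<eta> < \<bar>X n \<omega> - a\<bar> \<or> \<eta> < \<bar>Z n \<omega> - b\<bar>"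
    if "\<epsilon> > 0" for \<epsilon>
  proof (intro exI[of _ "\<epsilon> / 2"] conjI allI)
    fix n
    show "AE \<omega> in M. \<epsilon> < \<bar>Y n \<omega> - c\<bar> \<longrightarrow> \<epsilon> / 2 < \<bar>X n \<omega> - a\<bar> \<or> \<epsilon> / 2 < \<bar>Z n \<omega> - b\<bar>"
      using le[of n] by eventually_elim linarith
  qed (use that in simp)
qed

text \<open>Joint measurability makes the parameter integral measurable. The function
  \<open>h\<close> covers both the identity and the positive parts in the remainder.\<close>

lemma random_cdf_integral_measurable:
  assumes G: "random_cdf M G" and [measurable]: "h \<in> borel_measurable borel" "A \<in> sets borel"
  shows "(\<lambda>\<omega>. LBINT x:A. (h (G \<omega> x) :: real)) \<in> borel_measurable M"
proof -
  have [measurable]: "(\<lambda>(\<omega>, x). G \<omega> x) \<in> borel_measurable (M \<Otimes>\<^sub>M borel)"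
    using G by (simp add: random_cdf_def)
  show ?thesis
    unfolding set_lebesgue_integral_def by measurable
qed

section \<open>Quantile integrals under uniform convergence in probability\<close>

theorem corollary5p1:
  fixes M :: "'a measure"
    and p :: real
    and F :: "real \<Rightarrow> real"
    and Fn :: "nat \<Rightarrow> 'a \<Rightarrow> real \<Rightarrow> real"
  assumes "prob_space M"
    and "0 < p" and "p < 1"
    and "F \<in> F1_minus"
    and "\<And>n. random_cdf M (Fn n)"
    and "\<And>n. AE \<omega> in M. Fn n \<omega> \<in> F1_minus"
    and "conv_in_prob M (\<lambda>n \<omega>. SUP x. \<bar>Fn n \<omega> x - F x\<bar>) 0"
  shows "conv_in_prob M
           (\<lambda>n \<omega>. ((LBINT u=0..p. real_of_ereal (quantile (Fn n \<omega>) u))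
                   - (LBINT u=0..p. real_of_ereal (quantile F u)))
                  - (LBINT x=-\<infinity>..quantile F p. F x - Fn n \<omega> x)) 0
         \<and> (conv_in_prob M (\<lambda>n \<omega>. LBINT u=0..p. real_of_ereal (quantile (Fn n \<omega>) u))
              (LBINT u=0..p. real_of_ereal (quantile F u))
            \<longleftrightarrow>
            conv_in_prob M (\<lambda>n \<omega>. LBINT x=-\<infinity>..quantile F p. Fn n \<omega> x)
              (LBINT x=-\<infinity>..quantile F p. F x))"
proof -
  note M = assms(1) and p = assms(2,3) and F = assms(4) and rnd = assms(5) and Fn = assms(6)
    and unif = assms(7)
  have cdfF: "is_cdf F"
    using F by (simp add: F1_minus_def)
  define a where "a = real_of_ereal (quantile F p)"
  have q: "quantile F p = ereal a"
    using ereal_real_quantile[OF cdfF p] by (simp add: a_def)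
  have "einterval (- \<infinity>) (ereal a) = {..<a}"
    by (auto simp: einterval_iff)
  then have int_eq: "(LBINT x=-\<infinity>..quantile F p. f x) = (LBINT x:{..<a}. f x)" for f :: "real \<Rightarrow> real"
    by (simp add: q interval_lebesgue_integral_def)

  define A where "A = (\<lambda>n \<omega>. LBINT u=0..p. real_of_ereal (quantile (Fn n \<omega>) u))"
  define A0 where "A0 = (LBINT u=0..p. real_of_ereal (quantile F u))"
  define B where "B = (\<lambda>n \<omega>. LBINT x:{..<a}. Fn n \<omega> x)"
  define B0 where "B0 = (LBINT x:{..<a}. F x)"
  define D where "D = (\<lambda>n \<omega>. LBINT x:{..<a}. F x - Fn n \<omega> x)"
  define R where "R = (\<lambda>n \<omega>. quantile_remainder a p (Fn n \<omega>))"

  have AR: "AE \<omega> in M. A n \<omega> - A0 - D n \<omega> = R n \<omega> \<and> D n \<omega> = B0 - B n \<omega>" for n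
    using Fn[of n]
  proof eventually_elim
    case (elim \<omega>)
    then show ?case
      using F1_minus_integral_diff[OF F elim p]
        set_integral_diff(2)[OF F1_minus_integrable[OF F p] F1_minus_integrable[OF elim p], of a]
      by (simp add: A_def A0_def B_def B0_def D_def R_def a_def)
  qed

  have B_meas: "B n \<in> borel_measurable (completion M)" for n
    unfolding B_def
    by (intro measurable_completion random_cdf_integral_measurable[OF rnd, where h="\<lambda>y. y"]) auto
  have R_meas: "R n \<in> borel_measurable (completion M)" for n
    unfolding R_def quantile_remainder_def
    by (intro measurable_completion borel_measurable_add
        random_cdf_integral_measurable[OF rnd, where h="\<lambda>y. max 0 (y - p)"]
        random_cdf_integral_measurable[OF rnd, where h="\<lambda>y. max 0 (p - y)"]) auto
  \<comment> \<open>The quantile integral is almost surely equal to an expression in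
    \<open>R n\<close> and \<open>B n\<close>, so its measurability with respect to the completion
    is inherited from theirs.\<close>
  have A_meas: "A n \<in> borel_measurable (completion M)" for n
  proof (rule borel_measurable_completion_cong_AE)
    show "(\<lambda>\<omega>. R n \<omega> + A0 + B0 - B n \<omega>) \<in> borel_measurable (completion M)"
      using R_meas B_meas by measurable
    show "AE \<omega> in M. R n \<omega> + A0 + B0 - B n \<omega> = A n \<omega>"
      using AR[of n] by eventually_elim linarith
  qed

  \<comment> \<open>Half the distance from \<open>p\<close> to the nearer endpoint keeps
    \<open>p - \<eta>\<close> and \<open>p + \<eta>\<close> inside \<open>(0, 1)\<close>. The
    quantiles there are finite, and \<open>K\<close> is a deterministic constant.\<close>
  define \<eta> where "\<eta> = min p (1 - p) / 2"
  have \<eta>: "0 < \<eta>" "0 < p - \<eta>" "p + \<eta> < 1"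
    using p by (auto simp: \<eta>_def min_def field_simps)
  define K where "K = real_of_ereal (quantile F (p + \<eta>)) - real_of_ereal (quantile F (p - \<eta>))"
  have R_le: "AE \<omega> in M. (SUP x. \<bar>Fn n \<omega> x - F x\<bar>) \<le> \<eta> \<longrightarrow>
      R n \<omega> \<le> (SUP x. \<bar>Fn n \<omega> x - F x\<bar>) * K" for n
    using Fn[of n]
  proof eventually_elim
    case (elim \<omega>)
    have cdf: "is_cdf (Fn n \<omega>)"
      using elim by (simp add: F1_minus_def)
    \<comment> \<open>A real supremum is an upper bound only for a family bounded above; cdf values
      in \<open>[0, 1]\<close> provide this.\<close>
    have "\<bar>Fn n \<omega> x - F x\<bar> \<le> 1" for x
      using is_cdf_bounds[OF cdf, of x] is_cdf_bounds[OF cdfF, of x] by auto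
    then have "bdd_above (range (\<lambda>x. \<bar>Fn n \<omega> x - F x\<bar>))"
      by (intro bdd_aboveI[of _ 1]) auto
    then have le: "\<bar>Fn n \<omega> x - F x\<bar> \<le> (SUP x. \<bar>Fn n \<omega> x - F x\<bar>)" for x
      by (rule cSUP_upper[rotated]) simp
    show ?case
      unfolding R_def K_def a_def
      using quantile_remainder_bound[OF cdfF \<eta>(2,3) _ _ le] order_trans[OF abs_ge_zero le[of 0]]
      by blast
  qed

  have R_conv: "conv_in_prob M R 0"
  proof (rule conv_in_prob_dominated[OF M R_meas unif unif])
    fix \<epsilon> :: real assume \<epsilon>: "\<epsilon> > 0"
    \<comment> \<open>A sup distance of at most \<open>\<theta>\<close> is within the range
      \<open>\<eta>\<close> of the linear bound, which then gives at most \<open>\<epsilon>\<close>.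
      The added 1 prevents division by zero.\<close>
    define \<theta> where "\<theta> = min \<eta> (\<epsilon> / (\<bar>K\<bar> + 1))"
    have \<theta>: "0 < \<theta>" "\<theta> \<le> \<eta>" "\<theta> * (\<bar>K\<bar> + 1) \<le> \<epsilon>"
    proof -
      have K: "0 < \<bar>K\<bar> + 1"
        by linarith
      then show "0 < \<theta>" "\<theta> \<le> \<eta>"
        using \<eta> \<epsilon> by (auto simp: \<theta>_def)
      have "\<theta> \<le> \<epsilon> / (\<bar>K\<bar> + 1)"
        by (simp add: \<theta>_def)
      then show "\<theta> * (\<bar>K\<bar> + 1) \<le> \<epsilon>"
        using K by (simp only: pos_le_divide_eq)
    qed
    have large: "\<theta> < \<bar>s\<bar>" if "s \<le> \<eta> \<longrightarrow> r \<le> s * K" "\<epsilon> < r" for s r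
    proof (rule ccontr)
      assume "\<not> \<theta> < \<bar>s\<bar>"
      then have s: "\<bar>s\<bar> \<le> \<theta>" by simp
      have "s * K \<le> \<bar>s\<bar> * \<bar>K\<bar>"
        by (simp flip: abs_mult)
      also have "\<dots> \<le> \<theta> * (\<bar>K\<bar> + 1)"
        using s by (intro mult_mono) auto
      finally show False
        using that s \<theta> by auto
    qed
    show "\<exists>\<theta>>0. \<forall>n. AE \<omega> in M. \<epsilon> < \<bar>R n \<omega> - 0\<bar> \<longrightarrow>
        \<theta> < \<bar>(SUP x. \<bar>Fn n \<omega> x - F x\<bar>) - 0\<bar> \<or> \<theta> < \<bar>(SUP x. \<bar>Fn n \<omega> x - F x\<bar>) - 0\<bar>"
    proof (intro exI[of _ \<theta>] conjI allI)
      fix n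
      show "AE \<omega> in M. \<epsilon> < \<bar>R n \<omega> - 0\<bar> \<longrightarrow>
          \<theta> < \<bar>(SUP x. \<bar>Fn n \<omega> x - F x\<bar>) - 0\<bar> \<or> \<theta> < \<bar>(SUP x. \<bar>Fn n \<omega> x - F x\<bar>) - 0\<bar>"
        using R_le[of n]
      proof eventually_elim
        case (elim \<omega>)
        have "\<bar>R n \<omega> - 0\<bar> = R n \<omega>"
          by (simp add: R_def quantile_remainder_nonneg)
        then show ?case
          using large[OF elim] by simp
      qed
    qed (rule \<theta>(1))
  qed

  have "conv_in_prob M (\<lambda>n \<omega>. A n \<omega> - A0 - D n \<omega>) 0"
  proof (rule conv_in_prob_cong_AE[OF M R_conv])
    show "AE \<omega> in M. R n \<omega> = A n \<omega> - A0 - D n \<omega>" for n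
      using AR[of n] by eventually_elim simp
  qed
  \<comment> \<open>Almost surely
    \<open>A n \<omega> - A0 = R n \<omega> - (B n \<omega> - B0)\<close>, so each deviation is
    controlled by the other one and the vanishing remainder.\<close>
  moreover have "conv_in_prob M B B0" if "conv_in_prob M A A0"
  proof (rule conv_in_prob_triangle[OF M R_conv that B_meas])
    show "AE \<omega> in M. \<bar>B n \<omega> - B0\<bar> \<le> \<bar>R n \<omega> - 0\<bar> + \<bar>A n \<omega> - A0\<bar>" for n
      using AR[of n] by eventually_elim linarith
  qed
  moreover have "conv_in_prob M A A0" if "conv_in_prob M B B0"
  proof (rule conv_in_prob_triangle[OF M R_conv that A_meas])
    show "AE \<omega> in M. \<bar>A n \<omega> - A0\<bar> \<le> \<bar>R n \<omega> - 0\<bar> + \<bar>B n \<omega> - B0\<bar>" for n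
      using AR[of n] by eventually_elim linarith
  qed
  ultimately show ?thesis
    unfolding int_eq A_def A0_def B_def B0_def D_def by blast
qed

end
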